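(* Let $\Gamma$ and $\Gamma'$ be primitively log divergent graphs, and let $(u,v)\in E(\Gamma)$ and $(u',v')\in E(\Gamma')$ be edges. Then the gluing $\Gamma\times\Gamma'$ of $\Gamma$ and $\Gamma'$ along $(u,v)$ and $(u',v')$ is again primitively log divergent.
   Context: Graphs are finite, connected, with at least one edge, and without multiple edges or self-loops. For a graph $\Gamma$ let $h_1(\Gamma)=\mathrm{rank}\,H_1(\Gamma,\mathbb{Z})$. $\Gamma$ is convergent if $|E(\Gamma)|>2h_1(\Gamma)$ and logarithmically divergent if $|E(\Gamma)|=2h_1(\Gamma)$; a logarithmically divergent graph is primitively log divergent if every connected proper subgraph (with nonempty edge set a proper subset of the edges) is convergent. Gluing: $\Gamma\times\Gamma'$ is obtained from the disjoint union of $\Gamma$ and $\Gamma'$ by deleting the edges $(u,v)$ and $(u',v')$ and identifying the vertex $u$ with $u'$ and $v$ with $v'$. *)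

theory Defs
  imports "Graph_Theory.Graph_Theory" "HOL-Library.Function_Algebras"
begin

text \<open>
  Undirected graphs are symmetric digraphs: the locale \<^locale>\<open>pair_graph\<close> describes finite graphs
  without multiple edges or self-loops, and an undirected edge \<open>{x, y}\<close> is present iff both
  arcs \<open>(x, y)\<close> and \<open>(y, x)\<close> are.
\<close>

definition conn_graph :: "'a pair_pre_digraph \<Rightarrow> bool" where
  "conn_graph G \<longleftrightarrow> pair_graph G \<and> Digraph_Component.connected (with_proj G) \<and> parcs G \<noteq> {}"

definition edges :: "'a pair_pre_digraph \<Rightarrow> 'a set set" where
  "edges G = {{x, y} | x y. (x, y) \<in> parcs G}"

definition zscale :: "int \<Rightarrow> ('b \<Rightarrow> int) \<Rightarrow> ('b \<Rightarrow> int)" where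
  "zscale k f = (\<lambda>x. k * f x)"

interpretation zfun: module zscale
  by unfold_locales (auto simp: zscale_def fun_eq_iff algebra_simps)

text \<open>
  The rank of a subgroup \<open>A\<close> of a group of integer-valued functions. It is only meaningful when the
  cardinalities of independent subsets of \<open>A\<close> are bounded.
\<close>

definition zrank :: "('b \<Rightarrow> int) set \<Rightarrow> nat" where
  "zrank A = Max {card B | B. B \<subseteq> A \<and> finite B \<and> zfun.independent B}"

text \<open>
  Oriented simplicial chains with integer coefficients. The chain \<open>c\<close> stands for the sum of
  \<open>c (x, y) [x, y]\<close> over the edges \<open>{x, y}\<close>, one orientation chosen for each; antisymmetry
  expresses \<open>[y, x] = - [x, y]\<close> and makes the sum independent of the choice. The boundary of
  \<open>[x, y]\<close> is \<open>y - x\<close>.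
\<close>

definition chains1 :: "'a pair_pre_digraph \<Rightarrow> ('a \<times> 'a \<Rightarrow> int) set" where
  "chains1 G = {c. (\<forall>x y. c (y, x) = - c (x, y)) \<and> (\<forall>a. a \<notin> parcs G \<longrightarrow> c a = 0)}"

definition boundary1 :: "'a pair_pre_digraph \<Rightarrow> ('a \<times> 'a \<Rightarrow> int) \<Rightarrow> ('a \<Rightarrow> int)" where
  "boundary1 G c = (\<lambda>y. \<Sum>x | (x, y) \<in> parcs G. c (x, y))"

text \<open>A graph has no 2-simplices, so its first homology group is the group of 1-cycles.\<close>

definition H1 :: "'a pair_pre_digraph \<Rightarrow> ('a \<times> 'a \<Rightarrow> int) set" where
  "H1 G = {c \<in> chains1 G. boundary1 G c = 0}"

definition h1 :: "'a pair_pre_digraph \<Rightarrow> nat" where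
  "h1 G = zrank (H1 G)"

definition convergent_graph :: "'a pair_pre_digraph \<Rightarrow> bool" where
  "convergent_graph G \<longleftrightarrow> conn_graph G \<and> card (edges G) > 2 * h1 G"

definition log_divergent :: "'a pair_pre_digraph \<Rightarrow> bool" where
  "log_divergent G \<longleftrightarrow> conn_graph G \<and> card (edges G) = 2 * h1 G"

definition primitively_log_divergent :: "'a pair_pre_digraph \<Rightarrow> bool" where
  "primitively_log_divergent G \<longleftrightarrow>
     log_divergent G \<and>
     (\<forall>H. conn_graph H \<and> subgraph (with_proj H) (with_proj G) \<and> edges H \<subset> edges G
        \<longrightarrow> convergent_graph H)"

definition disj_union ::
  "'a pair_pre_digraph \<Rightarrow> 'b pair_pre_digraph \<Rightarrow> ('a + 'b) pair_pre_digraph" where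
  "disj_union G G' =
     \<lparr> pverts = pverts G <+> pverts G',
       parcs = map_prod Inl Inl ` parcs G \<union> map_prod Inr Inr ` parcs G' \<rparr>"

definition delete_edge :: "'a pair_pre_digraph \<Rightarrow> 'a \<Rightarrow> 'a \<Rightarrow> 'a pair_pre_digraph" where
  "delete_edge G x y = \<lparr> pverts = pverts G, parcs = parcs G - {(x, y), (y, x)} \<rparr>"

definition identify_map :: "'a \<Rightarrow> 'a \<Rightarrow> 'b \<Rightarrow> 'b \<Rightarrow> 'a + 'b \<Rightarrow> 'a + 'b" where
  "identify_map u v u' v' z =
     (if z = Inr u' then Inl u else if z = Inr v' then Inl v else z)"

definition image_graph :: "('a \<Rightarrow> 'b) \<Rightarrow> 'a pair_pre_digraph \<Rightarrow> 'b pair_pre_digraph" where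
  "image_graph q G = \<lparr> pverts = q ` pverts G, parcs = map_prod q q ` parcs G \<rparr>"

text \<open>
  The classes \<open>{u, u'}\<close> and \<open>{v, v'}\<close> of identified vertices are represented by \<open>u\<close> and \<open>v\<close>.
\<close>

definition gluing ::
  "'a pair_pre_digraph \<Rightarrow> 'a \<Rightarrow> 'a \<Rightarrow> 'b pair_pre_digraph \<Rightarrow> 'b \<Rightarrow> 'b \<Rightarrow> ('a + 'b) pair_pre_digraph" where
  "gluing G u v G' u' v' =
     image_graph (identify_map u v u' v')
       (delete_edge (delete_edge (disj_union G G') (Inl u) (Inl v)) (Inr u') (Inr v'))"

end

theory Submission
  imports Defs
begin

text \<open>
  For a connected graph \<open>h\<^sub>1 = |E| - |V| + 1\<close>, so a graph is log divergent iff \<open>|E| = 2 |V| - 2\<close> and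
  convergent iff \<open>|E| \<le> 2 |V| - 3\<close>. Splitting a disconnected graph into pieces only
  improves the second bound, hence a connected graph is primitively log divergent iff
  \<open>|E| = 2 |V| - 2\<close> and \<open>|F| \<le> 2 |X| - 3\<close> for every proper edge subset \<open>F\<close> supported on a set of
  at least two vertices \<open>X\<close>, connected or not: these are the circuits of the planar rigidity
  matroid, and the gluing is their 2-sum. The counts of the two sides of a subgraph of the gluing
  add up, with a correction for the shared vertices; only if both shared vertices are present is
  the bound missed by one edge, and then a side that is not exhausted can take back its deleted edge.
  The same counts show that a circuit has no bridge, so the gluing is connected.
\<close>

section \<open>Ranks of groups of integer-valued functions\<close>

text \<open>\<open>zrank\<close> is a \<open>Max\<close>, which says something only over a bounded
  set. This predicate carries the bound along with a set attaining it, so ranks can be computed by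
  induction without a separate finiteness argument.\<close>

definition has_zrank :: "('b \<Rightarrow> int) set \<Rightarrow> nat \<Rightarrow> bool" where
  "has_zrank A n \<longleftrightarrow>
     (\<exists>B\<subseteq>A. finite B \<and> zfun.independent B \<and> card B = n) \<and>
     (\<forall>B\<subseteq>A. finite B \<and> zfun.independent B \<longrightarrow> card B \<le> n)"

lemma zrank_eqI: "has_zrank A n \<Longrightarrow> zrank A = n"
  unfolding has_zrank_def zrank_def
  by (rule Max_eqI) (auto intro: finite_subset[of _ "{..n}"])

lemma has_zrank_zero: "has_zrank {0} 0"
proof -
  have "card B \<le> 0" if "B \<subseteq> {0}" "zfun.independent B" for B :: "('b \<Rightarrow> int) set"
    using that zfun.dependent_zero[of B] by (cases "B = {}") (simp, blast)
  then show ?thesis unfolding has_zrank_def using zfun.independent_empty by fastforce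
qed

lemma zscale_apply [simp]: "zscale k f x = k * f x"
  by (simp add: zscale_def)

lemma sum_zscale_apply: "(\<Sum>b\<in>B. zscale (k b) (f b)) x = (\<Sum>b\<in>B. k b * f b x)"
  by (induction B rule: infinite_finite_induct) auto

text \<open>Evaluation at \<open>a\<close> is a homomorphism from \<open>A\<close> to the integers;
  it is onto because \<open>c\<close> has value 1. Its kernel has rank \<open>n\<close> and its
  image rank 1.\<close>

lemma has_zrank_Suc:
  assumes sub: "zfun.subspace A" and c0: "c \<in> A" "c a = 1"
    and rank: "has_zrank {f \<in> A. f a = 0} n"
  shows "has_zrank A (Suc n)"
proof -
  let ?A0 = "{f \<in> A. f a = 0}"
  have "\<exists>B\<subseteq>A. finite B \<and> zfun.independent B \<and> card B = Suc n"
  proof -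
    obtain B where B: "B \<subseteq> ?A0" "finite B" "zfun.independent B" "card B = n"
      using rank unfolding has_zrank_def by blast
    have cB: "c \<notin> B" using B c0 by auto
    \<comment> \<open>All of \<open>B\<close> vanishes at \<open>a\<close>, so evaluating a relation
      there isolates the coefficient of \<open>c\<close>.\<close>
    have "zfun.independent (insert c B)"
    proof
      assume "zfun.dependent (insert c B)"
      then obtain k where k: "\<exists>b\<in>insert c B. k b \<noteq> 0" "(\<Sum>b\<in>insert c B. zscale (k b) b) = 0"
        using zfun.dependent_finite[of "insert c B"] B by auto
      have eq: "zscale (k c) c + (\<Sum>b\<in>B. zscale (k b) b) = 0"
        using k(2) B cB by simp
      have "(\<Sum>b\<in>B. zscale (k b) b) a = 0"
        unfolding sum_zscale_apply by (rule sum.neutral) (use B in auto)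
      with fun_cong[OF eq, of a] c0 have kc: "k c = 0" by simp
      with eq have "(\<Sum>b\<in>B. zscale (k b) b) = 0" by simp
      moreover have "\<exists>b\<in>B. k b \<noteq> 0" using k(1) kc by auto
      ultimately show False using B zfun.dependent_finite[of B] by blast
    qed
    then show ?thesis using B c0 cB by (intro exI[of _ "insert c B"]) auto
  qed
  moreover have "card B \<le> Suc n" if B: "B \<subseteq> A" "finite B" "zfun.independent B" for B
  proof (cases "B \<subseteq> ?A0")
    case True
    then show ?thesis using rank B unfolding has_zrank_def by (meson le_SucI)
  next
    case False
    then obtain b where b: "b \<in> B" "b a \<noteq> 0" using B by auto
    \<comment> \<open>Gaussian elimination with pivot \<open>b a\<close>, without dividing by it.\<close>
    define \<phi> where "\<phi> f = zscale (b a) f - zscale (f a) b" for f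
    let ?C = "B - {b}"
    \<comment> \<open>The relation is indexed by \<open>?C\<close>, not by its image under \<phi>,
      so that it yields both the injectivity of \<phi> on \<open>?C\<close> and the independence of
      the image.\<close>
    have sum\<phi>: "(\<Sum>f\<in>?C. zscale (k f) (\<phi> f)) = 0 \<Longrightarrow> \<forall>f\<in>?C. k f = 0" for k
    proof
      fix f assume z: "(\<Sum>f\<in>?C. zscale (k f) (\<phi> f)) = 0" and f: "f \<in> ?C"
      \<comment> \<open>These are the coefficients after expanding every \<open>\<phi> f\<close>:
        the pivot collects all the subtracted terms, and every other coefficient is multiplied by
        the nonzero integer \<open>b a\<close>, which can be cancelled at the end.\<close>
      define l where "l g = (if g = b then - (\<Sum>f\<in>?C. k f * f a) else k g * b a)" for g
      have "(\<Sum>g\<in>B. zscale (l g) g) = zscale (l b) b + (\<Sum>g\<in>?C. zscale (l g) g)"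
        using B b by (simp add: sum.remove)
      also have "\<dots> = (\<Sum>f\<in>?C. zscale (k f) (\<phi> f))"
      proof
        fix x
        have "(\<Sum>g\<in>?C. l g * g x) = (\<Sum>g\<in>?C. k g * b a * g x)"
          by (rule sum.cong) (auto simp: l_def)
        then show "(zscale (l b) b + (\<Sum>g\<in>?C. zscale (l g) g)) x = (\<Sum>f\<in>?C. zscale (k f) (\<phi> f)) x"
          by (simp add: sum_zscale_apply)
            (simp add: l_def \<phi>_def algebra_simps sum_distrib_left sum_subtractf)
      qed
      finally have "(\<Sum>g\<in>B. zscale (l g) g) = 0" using z by simp
      then have "l f = 0" using zfun.independentD[OF B(3) B(2)] f by blast
      then show "k f = 0" using f b by (auto simp: l_def)
    qed
    have inj: "inj_on \<phi> ?C"
    proof (rule inj_onI, rule ccontr)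
      fix f g assume fg: "f \<in> ?C" "g \<in> ?C" "\<phi> f = \<phi> g" "f \<noteq> g"
      \<comment> \<open>If \<open>\<phi> f = \<phi> g\<close>, the coefficients 1 and -1 give a
        nontrivial relation.\<close>
      define k where "k h = (if h = f then 1 else if h = g then - 1 else (0::int))" for h
      have "(\<Sum>h\<in>?C. zscale (k h) (\<phi> h)) = (\<Sum>h\<in>{f, g}. zscale (k h) (\<phi> h))"
        by (rule sum.mono_neutral_right) (use fg B in \<open>auto simp: k_def fun_eq_iff\<close>)
      also have "\<dots> = 0" using fg by (auto simp: k_def fun_eq_iff)
      finally have "k f = 0" using sum\<phi>[of k] fg by blast
      then show False by (simp add: k_def)
    qed
    have "zfun.independent (\<phi> ` ?C)"
    proof
      assume "zfun.dependent (\<phi> ` ?C)"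
      then obtain k where k: "\<exists>h\<in>\<phi> ` ?C. k h \<noteq> 0" "(\<Sum>h\<in>\<phi> ` ?C. zscale (k h) h) = 0"
        using zfun.dependent_finite[of "\<phi> ` ?C"] B by auto
      have "(\<Sum>f\<in>?C. zscale (k (\<phi> f)) (\<phi> f)) = 0"
        using k(2) inj by (simp add: sum.reindex)
      from sum\<phi>[OF this] k(1) show False by auto
    qed
    moreover have "\<phi> ` ?C \<subseteq> ?A0"
      using B b sub by (auto simp: \<phi>_def intro!: zfun.subspace_diff zfun.subspace_scale)
    ultimately have "card (\<phi> ` ?C) \<le> n"
      using rank B unfolding has_zrank_def by blast
    then show ?thesis using card_image[OF inj] B b by simp
  qed
  ultimately show ?thesis unfolding has_zrank_def by blast
qed

section \<open>The first Betti number of a connected graph\<close>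

text \<open>Vertex set and arc relation are kept as bare sets, with isolated vertices and
  disconnected graphs allowed, so that restricting, splitting and adding edges are plain set
  operations.\<close>

definition simple_arcs :: "'a set \<Rightarrow> 'a rel \<Rightarrow> bool" where
  "simple_arcs V R \<longleftrightarrow> finite V \<and> R \<subseteq> V \<times> V \<and> sym R \<and> irrefl R"

lemma simple_arcs_finite: "simple_arcs V R \<Longrightarrow> finite R"
  unfolding simple_arcs_def by (meson finite_SigmaI finite_subset)

lemma simple_arcsI:
  assumes "finite V" "\<And>x y. (x, y) \<in> R \<Longrightarrow> (y, x) \<in> R \<and> x \<in> V \<and> y \<in> V \<and> x \<noteq> y"
  shows "simple_arcs V R"
  unfolding simple_arcs_def using assms by (auto intro!: symI irreflI)

lemma simple_arcsD:
  assumes "simple_arcs V R" "(x, y) \<in> R"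
  shows "(y, x) \<in> R" "x \<in> V" "y \<in> V" "x \<noteq> y"
  using assms unfolding simple_arcs_def by (auto dest: symD irreflD)

section \<open>Integral chains and cycles of an arc relation\<close>

definition chains :: "'a rel \<Rightarrow> ('a \<times> 'a \<Rightarrow> int) set" where
  "chains R = {c. (\<forall>x y. c (y, x) = - c (x, y)) \<and> (\<forall>a. a \<notin> R \<longrightarrow> c a = 0)}"

lemma chainsI:
  "(\<And>x y. c (y, x) = - c (x, y)) \<Longrightarrow> (\<And>a. a \<notin> R \<Longrightarrow> c a = 0) \<Longrightarrow> c \<in> chains R"
  unfolding chains_def by blast

lemma chains_swap: "c \<in> chains R \<Longrightarrow> c (y, x) = - c (x, y)"
  unfolding chains_def by blast

lemma chains_eq_0: "c \<in> chains R \<Longrightarrow> a \<notin> R \<Longrightarrow> c a = 0"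
  unfolding chains_def by blast

lemma zero_chain: "0 \<in> chains R"
  by (rule chainsI) simp_all

lemma chains_mono: "R \<subseteq> S \<Longrightarrow> chains R \<subseteq> chains S"
  unfolding chains_def by blast

text \<open>The boundary is summed over all of \<open>V\<close> rather than over the arcs into
  \<open>y\<close>: the index set then does not change when edges are added, and chains vanish on
  the extra pairs.\<close>

definition cycles :: "'a set \<Rightarrow> 'a rel \<Rightarrow> ('a \<times> 'a \<Rightarrow> int) set" where
  "cycles V R = {c \<in> chains R. \<forall>y. (\<Sum>x\<in>V. c (x, y)) = 0}"

lemma H1_eq_cycles:
  assumes "simple_arcs (pverts G) (parcs G)"
  shows "H1 G = cycles (pverts G) (parcs G)"
proof -
  have "(\<Sum>x | (x, y) \<in> parcs G. c (x, y)) = (\<Sum>x\<in>pverts G. c (x, y))"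
    if "c \<in> chains (parcs G)" for c y
    by (rule sum.mono_neutral_left) (use assms that in \<open>auto simp: simple_arcs_def chains_eq_0\<close>)
  then have "boundary1 G c = 0 \<longleftrightarrow> (\<forall>y. (\<Sum>x\<in>pverts G. c (x, y)) = 0)" if "c \<in> chains (parcs G)" for c
    using that by (simp add: boundary1_def fun_eq_iff)
  then show ?thesis
    unfolding H1_def cycles_def chains1_def chains_def[symmetric] by blast
qed

lemma subspace_cycles: "zfun.subspace (cycles V R)"
proof (rule zfun.subspaceI)
  show "0 \<in> cycles V R" by (simp add: cycles_def zero_chain)
next
  fix c d assume "c \<in> cycles V R" "d \<in> cycles V R"
  then have c: "c \<in> chains R" "\<And>y. (\<Sum>x\<in>V. c (x, y)) = 0"
    and d: "d \<in> chains R" "\<And>y. (\<Sum>x\<in>V. d (x, y)) = 0" by (auto simp: cycles_def)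
  have "c + d \<in> chains R"
  proof (rule chainsI)
    show "(c + d) (y, x) = - (c + d) (x, y)" for x y
      using chains_swap[OF c(1), of y x] chains_swap[OF d(1), of y x] by simp
  qed (use c d in \<open>simp add: chains_eq_0\<close>)
  then show "c + d \<in> cycles V R" using c d by (simp add: cycles_def sum.distrib)
next
  fix k c assume "c \<in> cycles V R"
  then have c: "c \<in> chains R" "\<And>y. (\<Sum>x\<in>V. c (x, y)) = 0" by (auto simp: cycles_def)
  have "zscale k c \<in> chains R"
  proof (rule chainsI)
    show "zscale k c (y, x) = - zscale k c (x, y)" for x y
      using chains_swap[OF c(1), of y x] by simp
  qed (use c in \<open>simp add: chains_eq_0\<close>)
  then show "zscale k c \<in> cycles V R"
    using c by (simp add: cycles_def sum_distrib_left[symmetric])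
qed

text \<open>The oriented edge \<open>[x, y]\<close> as a chain. As a difference of two indicators it
  is antisymmetric even for \<open>x = y\<close>, where it is zero.\<close>

definition arc_chain :: "'a \<Rightarrow> 'a \<Rightarrow> 'a \<times> 'a \<Rightarrow> int" where
  "arc_chain x y a = (if a = (x, y) then 1 else 0) - (if a = (y, x) then 1 else 0)"

lemma arc_chain_swap: "arc_chain x y (q, p) = - arc_chain x y (p, q)"
  unfolding arc_chain_def prod.inject minus_diff_eq by (simp only: conj_commute)

lemma sum_arc_chain:
  assumes "finite V" "x \<in> V" "y \<in> V"
  shows "(\<Sum>w\<in>V. arc_chain x y (w, z)) = of_bool (z = y) - of_bool (z = x)"
proof -
  have "(\<Sum>w\<in>V. arc_chain x y (w, z)) =
      (\<Sum>w\<in>V. if w = x then of_bool (z = y) else 0) - (\<Sum>w\<in>V. if w = y then of_bool (z = x) else 0)"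
    unfolding sum_subtractf[symmetric] by (rule sum.cong) (auto simp: arc_chain_def)
  then show ?thesis using assms by (simp add: sum.delta)
qed

lemma add_arc_chain:
  assumes c: "c \<in> chains R" and R: "(x, y) \<in> R" "(y, x) \<in> R"
  shows "(\<lambda>a. c a + arc_chain x y a) \<in> chains R"
proof (rule chainsI)
  show "c (q, p) + arc_chain x y (q, p) = - (c (p, q) + arc_chain x y (p, q))" for p q
    using chains_swap[OF c, of q p] arc_chain_swap[of x y q p] by linarith
  fix a assume a: "a \<notin> R"
  then have "a \<noteq> (x, y)" "a \<noteq> (y, x)" using R by metis+
  then show "c a + arc_chain x y a = 0" using chains_eq_0[OF c a] by (simp add: arc_chain_def)
qed

text \<open>Adding up the oriented edges along a path makes the boundary telescope to its end minus
  its start.\<close>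

lemma path_chain:
  assumes "(x, y) \<in> R\<^sup>*" "simple_arcs V R"
  shows "\<exists>c\<in>chains R. \<forall>z. (\<Sum>w\<in>V. c (w, z)) = of_bool (z = y) - of_bool (z = x)"
  using assms(1)
proof induction
  case base
  show ?case by (rule bexI[OF _ zero_chain]) simp
next
  case (step y z)
  then obtain c where c: "c \<in> chains R"
    "\<And>t. (\<Sum>w\<in>V. c (w, t)) = of_bool (t = y) - of_bool (t = x)" by blast
  have R: "(y, z) \<in> R" "(z, y) \<in> R" "finite V" "y \<in> V" "z \<in> V"
    using step assms(2) by (auto simp: simple_arcs_def sym_def)
  have "(\<lambda>a. c a + arc_chain y z a) \<in> chains R"
    using c(1) R by (intro add_arc_chain)
  moreover have "(\<Sum>w\<in>V. c (w, t) + arc_chain y z (w, t)) = of_bool (t = z) - of_bool (t = x)" for t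
    using R by (simp add: sum.distrib c sum_arc_chain)
  ultimately show ?case by (intro bexI[of _ "\<lambda>a. c a + arc_chain y z a"]) auto
qed

text \<open>
  The third argument counts the chords: each chord closes exactly one new independent cycle, while
  a new leaf closes none.
\<close>

inductive built :: "'a set \<Rightarrow> 'a rel \<Rightarrow> nat \<Rightarrow> bool" where
  point: "built {x} {} 0"
| leaf: "built V R k \<Longrightarrow> x \<in> V \<Longrightarrow> y \<notin> V \<Longrightarrow> built (insert y V) (R \<union> {(x, y), (y, x)}) k"
| chord: "built V R k \<Longrightarrow> x \<in> V \<Longrightarrow> y \<in> V \<Longrightarrow> x \<noteq> y \<Longrightarrow> (x, y) \<notin> R \<Longrightarrow>
    built V (R \<union> {(x, y), (y, x)}) (Suc k)"

lemma built_simple: "built V R k \<Longrightarrow> simple_arcs V R"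
  by (induction rule: built.induct) (auto simp: simple_arcs_def sym_def irrefl_def)

lemma built_connected: "built V R k \<Longrightarrow> p \<in> V \<Longrightarrow> q \<in> V \<Longrightarrow> (p, q) \<in> R\<^sup>*"
proof (induction arbitrary: p q rule: built.induct)
  case (leaf V R k x y)
  let ?R = "R \<union> {(x, y), (y, x)}"
  have V: "(p, q) \<in> ?R\<^sup>*" if "p \<in> V" "q \<in> V" for p q
    using leaf.IH[OF that] by (intro in_rtrancl_UnI disjI1)
  have x: "(p, x) \<in> ?R\<^sup>* \<and> (x, p) \<in> ?R\<^sup>*" if "p \<in> insert y V" for p
    using that V leaf.hyps by auto
  from x[OF leaf.prems(1)] x[OF leaf.prems(2)] show ?case by (meson rtrancl_trans)
next
  case (chord V R k x y)
  then show ?case by (intro in_rtrancl_UnI disjI1)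
qed auto

text \<open>Every edge contributes two arcs, so this is twice the Euler relation
  \<open>|E| + 1 = |V| + k\<close>: a leaf adds one vertex and one edge, a chord only an
  edge.\<close>

lemma built_card: "built V R k \<Longrightarrow> card R + 2 = 2 * card V + 2 * k"
proof (induction rule: built.induct)
  case (leaf V R k x y)
  have s: "simple_arcs V R" using leaf built_simple by blast
  then have "(x, y) \<notin> R" "(y, x) \<notin> R" "x \<noteq> y" "finite R" "finite V"
    using leaf simple_arcs_finite by (auto simp: simple_arcs_def)
  then show ?case using leaf by simp
next
  case (chord V R k x y)
  have s: "simple_arcs V R" using chord built_simple by blast
  have "(y, x) \<notin> R" using chord(5) simple_arcsD(1)[OF s, of y x] by blast
  moreover have "finite R" using s by (rule simple_arcs_finite)
  ultimately show ?case using chord by simp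
qed auto

lemma built_zrank: "built V R k \<Longrightarrow> has_zrank (cycles V R) k"
proof (induction rule: built.induct)
  case (point x)
  have "cycles {x} {} = {0}"
    by (auto simp: cycles_def zero_chain chains_eq_0 fun_eq_iff)
  then show ?case using has_zrank_zero by simp
next
  case (leaf V R k x y)
  let ?R = "R \<union> {(x, y), (y, x)}"
  have V: "finite V" "R \<subseteq> V \<times> V" "x \<noteq> y"
    using built_simple[OF leaf(1)] leaf by (auto simp: simple_arcs_def)
  have ch: "c \<in> chains R" if c: "c \<in> cycles (insert y V) ?R" for c
  proof -
    have c': "c \<in> chains ?R" using c by (simp add: cycles_def)
    \<comment> \<open>The only arc into the new leaf \<open>y\<close> comes from \<open>x\<close>,
      so the cycle condition at \<open>y\<close> forces the coefficient of the new edge to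
      vanish.\<close>
    have "(\<Sum>w\<in>insert y V. c (w, y)) = (\<Sum>w\<in>{x}. c (w, y))"
      by (rule sum.mono_neutral_right) (use V leaf chains_eq_0[OF c'] in auto)
    moreover have "(\<Sum>w\<in>insert y V. c (w, y)) = 0" using c by (simp add: cycles_def)
    ultimately have "c (x, y) = 0" "c (y, x) = 0" using chains_swap[OF c', of y x] by auto
    then have "c a = 0" if "a \<notin> R" for a using chains_eq_0[OF c', of a] that by auto
    then show ?thesis using chains_swap[OF c'] by (intro chainsI)
  qed
  have y0: "c (y, z) = 0" if "c \<in> chains R" for c z
    using chains_eq_0[OF that] V leaf(3) by auto
  have "cycles (insert y V) ?R = cycles V R"
  proof (intro equalityI subsetI)
    fix c assume c: "c \<in> cycles (insert y V) ?R"
    with ch[OF this] y0[OF ch[OF this]] V leaf show "c \<in> cycles V R" by (simp add: cycles_def)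
  next
    fix c assume "c \<in> cycles V R"
    then have c: "c \<in> chains R" "\<And>z. (\<Sum>w\<in>V. c (w, z)) = 0" by (auto simp: cycles_def)
    then show "c \<in> cycles (insert y V) ?R"
      using y0[OF c(1)] chains_mono[of R ?R] V leaf by (auto simp: cycles_def)
  qed
  then show ?case using leaf by simp
next
  case (chord V R k x y)
  let ?R = "R \<union> {(x, y), (y, x)}"
  have s: "simple_arcs V R" using chord built_simple by blast
  then have fin: "finite V" by (simp add: simple_arcs_def)
  \<comment> \<open>A path from \<open>y\<close> back to \<open>x\<close> in the old graph; the
    chord from \<open>x\<close> to \<open>y\<close> closes it to a cycle with coefficient 1 on the
    chord.\<close>
  obtain c where c: "c \<in> chains R"
    "\<And>t. (\<Sum>w\<in>V. c (w, t)) = of_bool (t = x) - of_bool (t = y)"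
    using path_chain[OF built_connected[OF chord(1) chord(3) chord(2)] s] by blast
  let ?c = "\<lambda>a. c a + arc_chain x y a"
  have "c (x, y) = 0" using c chord by (auto simp: chains_eq_0)
  then have c1: "?c (x, y) = 1" using chord by (simp add: arc_chain_def)
  have "?c \<in> chains ?R"
    using add_arc_chain[of c ?R x y] c(1) chains_mono[of R ?R] by auto
  then have "?c \<in> cycles V ?R"
    using c(2) fin chord by (simp add: cycles_def sum.distrib sum_arc_chain)
  \<comment> \<open>The kernel of evaluation at the chord is the old cycle group, so
    \<open>has_zrank_Suc\<close> adds exactly one to the rank.\<close>
  moreover have "{f \<in> cycles V ?R. f (x, y) = 0} = cycles V R"
  proof (intro equalityI subsetI)
    fix f assume f: "f \<in> {f \<in> cycles V ?R. f (x, y) = 0}"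
    then have f': "f \<in> chains ?R" "f (x, y) = 0" by (auto simp: cycles_def)
    then have "f (y, x) = 0" using chains_swap[OF f'(1), of y x] by simp
    then have "f a = 0" if "a \<notin> R" for a using chains_eq_0[OF f'(1), of a] that f'(2) by auto
    then have "f \<in> chains R" using chains_swap[OF f'(1)] by (intro chainsI)
    with f show "f \<in> cycles V R" by (simp add: cycles_def)
  next
    fix f assume "f \<in> cycles V R"
    then show "f \<in> {f \<in> cycles V ?R. f (x, y) = 0}"
      using chains_mono[of R ?R] chord by (auto simp: cycles_def chains_eq_0)
  qed
  ultimately show ?case
    using has_zrank_Suc[OF subspace_cycles, of ?c V ?R "(x, y)" k] c1 chord by simp
qed

text \<open>A built subgraph with the largest number of arcs admits no further leaf or chord. It is
  therefore closed under following arcs of \<open>R\<close>, and connectivity makes it the whole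
  graph.\<close>

lemma connected_built:
  assumes "simple_arcs V R" "V \<noteq> {}" and conn: "\<And>x y. x \<in> V \<Longrightarrow> y \<in> V \<Longrightarrow> (x, y) \<in> R\<^sup>*"
  shows "\<exists>k. built V R k"
proof -
  have fin: "finite R" using assms simple_arcs_finite by blast
  obtain a where a: "a \<in> V" using assms by blast
  define P where "P p \<longleftrightarrow> (\<exists>k. built (fst p) (snd p) k) \<and> fst p \<subseteq> V \<and> snd p \<subseteq> R" for p
  have "P ({a}, {})" using a built.point[of a] by (auto simp: P_def)
  moreover have "\<forall>p. P p \<longrightarrow> card (snd p) < Suc (card R)"
    using fin by (auto simp: P_def less_Suc_eq_le intro: card_mono)
  ultimately have "\<exists>p. P p \<and> (\<forall>q. P q \<longrightarrow> card (snd q) \<le> card (snd p))"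
    by (rule Lattices_Big.ex_has_greatest_nat)
  then obtain p where p: "P p" and max: "\<And>q. P q \<Longrightarrow> card (snd q) \<le> card (snd p)"
    by blast
  define U S where "U = fst p" and US: "S = snd p"
  with p obtain k where k: "built U S k" "U \<subseteq> V" "S \<subseteq> R" unfolding P_def by blast
  have s: "simple_arcs U S" using k(1) by (rule built_simple)
  have S: "finite S" using s by (rule simple_arcs_finite)
  \<comment> \<open>A missing arc that starts in \<open>U\<close> could be added as a chord if it
    ends in \<open>U\<close> and as a leaf otherwise, against maximality.\<close>
  have closed: "(x, y) \<in> S" if "x \<in> U" "(x, y) \<in> R" for x y
  proof (rule ccontr)
    assume n: "(x, y) \<notin> S"
    have xy: "x \<noteq> y" "y \<in> V" "(y, x) \<in> R"
      using simple_arcsD[OF assms(1) that(2)] by simp_all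
    let ?S = "S \<union> {(x, y), (y, x)}"
    have "P (insert y U, ?S)"
    proof (cases "y \<in> U")
      case True
      then show ?thesis using built.chord[OF k(1) that(1) True xy(1) n] k that xy
        by (auto simp: P_def insert_absorb)
    next
      case False
      then show ?thesis using built.leaf[OF k(1) that(1) False] k that xy
        by (auto simp: P_def)
    qed
    from max[OF this] have "card ?S \<le> card S" by (simp add: US)
    moreover have "card S < card ?S" using n S by (intro psubset_card_mono) auto
    ultimately show False by simp
  qed
  have "U \<noteq> {}" using k(1) by cases auto
  then obtain b where b: "b \<in> U" by blast
  have "y \<in> U" if "(b, y) \<in> R\<^sup>*" for y
    using that by induction (use b closed s in \<open>auto simp: simple_arcs_def\<close>)
  then have "U = V" using conn b k by blast
  moreover have "S = R" using closed k assms calculation by (auto simp: simple_arcs_def)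
  ultimately show ?thesis using k by blast
qed

section \<open>From graphs to vertex sets with arc relations\<close>

lemma pair_graph_iff: "pair_graph G \<longleftrightarrow> simple_arcs (pverts G) (parcs G)"
proof
  assume "pair_graph G"
  then interpret pair_graph G .
  show "simple_arcs (pverts G) (parcs G)"
    using pair_finite_verts in_arcsD1 in_arcsD2 pair_sym_arcs pair_no_loops
    by (fastforce simp: simple_arcs_def symmetric_def irrefl_def)
next
  assume s: "simple_arcs (pverts G) (parcs G)"
  show "pair_graph G"
    by unfold_locales
      (use s simple_arcs_finite[OF s] in \<open>auto simp: simple_arcs_def symmetric_def irrefl_def\<close>)
qed

text \<open>Arcs are symmetric and have their ends among the vertices, so neither the symmetric
  closure nor the restriction of paths to the vertex set in the library's notion of connectedness
  changes anything.\<close>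

lemma conn_graph_iff:
  "conn_graph G \<longleftrightarrow> simple_arcs (pverts G) (parcs G) \<and> parcs G \<noteq> {} \<and>
     (\<forall>x\<in>pverts G. \<forall>y\<in>pverts G. (x, y) \<in> (parcs G)\<^sup>*)"
proof (cases "pair_graph G")
  case True
  then interpret pair_graph G .
  have mk: "parcs (mk_symmetric (with_proj G)) = parcs G"
    using adj_mk_symmetric_eq[OF pair_sym_arcs] by simp
  have "(x, y) \<in> rtrancl_on (pverts G) (parcs G) \<longleftrightarrow> (x, y) \<in> (parcs G)\<^sup>*"
    if "x \<in> pverts G" "y \<in> pverts G" for x y
    using that in_arcsD2
    by (auto intro: rtrancl_on_rtranclI rtrancl_consistent_rtrancl_on)
  moreover have "parcs G \<noteq> {} \<Longrightarrow> pverts G \<noteq> {}" using in_arcsD1 by auto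
  ultimately show ?thesis
    using True pair_graph_iff[of G]
    unfolding conn_graph_def Digraph_Component.connected_def strongly_connected_def reachable_def
    by (auto simp: mk)
qed (auto simp: conn_graph_def pair_graph_iff)

lemma card_arcs:
  assumes "simple_arcs V (parcs G)"
  shows "card (parcs G) = 2 * card (edges G)"
proof -
  let ?f = "\<lambda>(x, y). {x, y}"
  have fin: "finite (parcs G)" using assms simple_arcs_finite by blast
  have e: "edges G = ?f ` parcs G" by (auto simp: edges_def)
  have "card (parcs G) = (\<Sum>e\<in>edges G. card {a \<in> parcs G. ?f a = e})"
    unfolding e card_eq_sum by (rule sum.image_gen[OF fin])
  also have "\<dots> = (\<Sum>e\<in>edges G. 2)"
  proof (rule sum.cong[OF refl])
    fix e assume "e \<in> edges G"
    then obtain x y where xy: "e = {x, y}" "(x, y) \<in> parcs G" by (auto simp: edges_def)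
    then have "x \<noteq> y" "(y, x) \<in> parcs G" using simple_arcsD[OF assms] by blast+
    moreover from this have "{a \<in> parcs G. ?f a = e} = {(x, y), (y, x)}"
      using xy by (auto simp: doubleton_eq_iff)
    ultimately show "card {a \<in> parcs G. ?f a = e} = 2" by simp
  qed
  finally show ?thesis by simp
qed

text \<open>The number of chords in a construction of the graph is its cycle rank by
  \<open>built_zrank\<close> and is determined by the vertex and edge counts by
  \<open>built_card\<close>.\<close>

lemma h1_eq:
  assumes "conn_graph G"
  shows "h1 G + card (pverts G) = card (edges G) + 1"
proof -
  have s: "simple_arcs (pverts G) (parcs G)" using assms conn_graph_iff by blast
  moreover have "pverts G \<noteq> {}" using assms s by (auto simp: conn_graph_iff simple_arcs_def)
  ultimately obtain k where k: "built (pverts G) (parcs G) k"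
    using connected_built assms conn_graph_iff by metis
  have "h1 G = k"
    unfolding h1_def H1_eq_cycles[OF s] using built_zrank[OF k] by (rule zrank_eqI)
  then show ?thesis using built_card[OF k] card_arcs[OF s] by simp
qed

lemma conn_graph_card_arcs:
  assumes "conn_graph G"
  shows "card (parcs G) = 2 * card (edges G)"
  using assms card_arcs conn_graph_iff by blast

lemma log_divergent_iff:
  "log_divergent G \<longleftrightarrow> conn_graph G \<and> card (parcs G) + 4 = 4 * card (pverts G)"
proof (cases "conn_graph G")
  case True
  with h1_eq[OF this] conn_graph_card_arcs[OF this] show ?thesis
    unfolding log_divergent_def by linarith
qed (simp add: log_divergent_def)

text \<open>Strictness costs one edge, hence two arcs: this is why 4 in the log divergent case
  becomes 6 here.\<close>

lemma convergent_graph_iff: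
  "convergent_graph G \<longleftrightarrow> conn_graph G \<and> card (parcs G) + 6 \<le> 4 * card (pverts G)"
proof (cases "conn_graph G")
  case True
  with h1_eq[OF this] conn_graph_card_arcs[OF this] show ?thesis
    unfolding convergent_graph_def by linarith
qed (simp add: convergent_graph_def)

section \<open>A connectivity-free edge count\<close>

text \<open>
  \<open>card R\<close> counts arcs, that is, every edge twice: the conditions read \<open>|E| = 2 |V| - 2\<close> and
  \<open>|E| \<le> 2 |V| - 3\<close>.
\<close>

definition tight_circuit :: "'a set \<Rightarrow> 'a rel \<Rightarrow> bool" where
  "tight_circuit V R \<longleftrightarrow>
     card R + 4 = 4 * card V \<and>
     (\<forall>X S. X \<subseteq> V \<and> S \<subseteq> R \<and> S \<noteq> R \<and> simple_arcs X S \<and> 2 \<le> card X \<longrightarrow>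
        card S + 6 \<le> 4 * card X)"

lemma simple_arcs_restrict:
  assumes "simple_arcs X S" "Y \<subseteq> X"
  shows "simple_arcs Y (S \<inter> Y \<times> Y)"
proof (rule simple_arcsI)
  show "finite Y" using assms finite_subset unfolding simple_arcs_def by blast
qed (use simple_arcsD[OF assms(1)] in blast)

lemma simple_arcs_small:
  assumes "simple_arcs X S" "card X < 2"
  shows "S = {}"
proof (rule equals0I)
  fix a assume "a \<in> S"
  then obtain x y where "(x, y) \<in> S" by (cases a) auto
  from simple_arcsD[OF assms(1) this] have "{x, y} \<subseteq> X" "card {x, y} = 2" by auto
  moreover have "finite X" using assms by (simp add: simple_arcs_def)
  ultimately show False using card_mono[of X "{x, y}"] assms by simp
qed

text \<open>Induction on the number of vertices. A disconnected graph splits into two parts without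
  arcs between them, and the two bounds add up to something stronger than what is claimed.\<close>

lemma card_arcs_bound_of_connected:
  assumes conn: "\<And>Y T. Y \<subseteq> X \<Longrightarrow> T \<subseteq> S \<Longrightarrow> simple_arcs Y T \<Longrightarrow> T \<noteq> {} \<Longrightarrow>
      \<forall>x\<in>Y. \<forall>y\<in>Y. (x, y) \<in> T\<^sup>* \<Longrightarrow> card T + 6 \<le> 4 * card Y"
    and S: "simple_arcs X S" and X: "2 \<le> card X"
  shows "card S + 6 \<le> 4 * card X"
  using assms
proof (induction "card X" arbitrary: X S rule: less_induct)
  case less
  have finX: "finite X" using less.prems(2) by (simp add: simple_arcs_def)
  consider "S = {}" | "S \<noteq> {}" "\<forall>x\<in>X. \<forall>y\<in>X. (x, y) \<in> S\<^sup>*"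
    | x y where "x \<in> X" "y \<in> X" "(x, y) \<notin> S\<^sup>*" by blast
  then show ?case
  proof cases
    case 1
    then show ?thesis using less.prems(3) by simp
  next
    case 2
    then show ?thesis using less.prems(1)[OF order_refl order_refl less.prems(2)] by blast
  next
    case 3
    define Y where "Y = {z \<in> X. (x, z) \<in> S\<^sup>*}"
    define Z where "Z = X - Y"
    have YZ: "Y \<union> Z = X" "Y \<inter> Z = {}" "x \<in> Y" "y \<in> Z" "Y \<subseteq> X" "Z \<subseteq> X"
      using 3 by (auto simp: Y_def Z_def)
    have fin: "finite Y" "finite Z" using finX YZ(5,6) finite_subset by blast+
    have cards: "card Y + card Z = card X" "0 < card Y" "0 < card Z"
      using card_Un_disjoint[OF fin YZ(2)] YZ fin by (auto simp: card_gt_0_iff)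
    \<comment> \<open>The weaker constant 4 also covers a single vertex, where 6 would fail. Two
      such parts give 8 in total, more than the 6 required.\<close>
    have part: "card (S \<inter> U \<times> U) + 4 \<le> 4 * card U"
      if U: "U \<subseteq> X" "card U < card X" "0 < card U" for U
    proof (cases "2 \<le> card U")
      case True
      have "card (S \<inter> U \<times> U) + 6 \<le> 4 * card U"
      proof (rule less.hyps[OF U(2) _ simple_arcs_restrict[OF less.prems(2) U(1)] True])
        fix A T assume "A \<subseteq> U" "T \<subseteq> S \<inter> U \<times> U" and *: "simple_arcs A T" "T \<noteq> {}"
          "\<forall>x\<in>A. \<forall>y\<in>A. (x, y) \<in> T\<^sup>*"
        then have "A \<subseteq> X" "T \<subseteq> S" using U by blast+
        from less.prems(1)[OF this *] show "card T + 6 \<le> 4 * card A" .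
      qed
      then show ?thesis by simp
    next
      case False
      then have "S \<inter> U \<times> U = {}"
        using simple_arcs_small[OF simple_arcs_restrict[OF less.prems(2) U(1)]] by simp
      then show ?thesis using U by simp
    qed
    have "S \<subseteq> (S \<inter> Y \<times> Y) \<union> (S \<inter> Z \<times> Z)"
    proof
      fix a assume "a \<in> S"
      obtain p q where a: "a = (p, q)" by (cases a)
      then have pq: "(p, q) \<in> S" "(q, p) \<in> S" "p \<in> X" "q \<in> X"
        using simple_arcsD[OF less.prems(2), of p q] \<open>a \<in> S\<close> by simp_all
      have "p \<in> Y \<longleftrightarrow> q \<in> Y"
        unfolding Y_def using pq by (auto intro: rtrancl_into_rtrancl)
      then show "a \<in> (S \<inter> Y \<times> Y) \<union> (S \<inter> Z \<times> Z)" using pq a by (auto simp: Z_def)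
    qed
    then have "card S \<le> card ((S \<inter> Y \<times> Y) \<union> (S \<inter> Z \<times> Z))"
      by (rule card_mono[rotated]) (use fin in simp)
    also have "\<dots> \<le> card (S \<inter> Y \<times> Y) + card (S \<inter> Z \<times> Z)" by (rule card_Un_le)
    finally show ?thesis using part[OF YZ(5)] part[OF YZ(6)] cards by linarith
  qed
qed

section \<open>Primitive log divergence as a counting condition\<close>

lemma wf_digraph_with_proj:
  assumes "simple_arcs (pverts G) (parcs G)"
  shows "wf_digraph (with_proj G)"
  by unfold_locales (use simple_arcsD[OF assms] in force)+

lemma proper_subgraph_iff:
  assumes G: "simple_arcs (pverts G) (parcs G)" and H: "simple_arcs (pverts H) (parcs H)"
  shows "subgraph (with_proj H) (with_proj G) \<and> edges H \<subset> edges G \<longleftrightarrow>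
    pverts H \<subseteq> pverts G \<and> parcs H \<subset> parcs G"
proof -
  have sub: "subgraph (with_proj H) (with_proj G) \<longleftrightarrow> pverts H \<subseteq> pverts G \<and> parcs H \<subseteq> parcs G"
    using wf_digraph_with_proj[OF G] wf_digraph_with_proj[OF H]
    by (auto simp: subgraph_def)
  have "edges H \<subset> edges G \<longleftrightarrow> parcs H \<subset> parcs G" if HG: "parcs H \<subseteq> parcs G"
  proof
    assume "edges H \<subset> edges G"
    then have "parcs H \<noteq> parcs G" unfolding edges_def by blast
    then show "parcs H \<subset> parcs G" using HG by blast
  next
    assume "parcs H \<subset> parcs G"
    then obtain x y where xy: "(x, y) \<in> parcs G" "(x, y) \<notin> parcs H" by auto
    then have "(y, x) \<notin> parcs H" using simple_arcsD(1)[OF H, of y x] by blast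
    then have "{x, y} \<notin> edges H" using xy(2) by (auto simp: edges_def doubleton_eq_iff)
    moreover have "{x, y} \<in> edges G" using xy(1) by (auto simp: edges_def)
    moreover have "edges H \<subseteq> edges G" using HG unfolding edges_def by blast
    ultimately show "edges H \<subset> edges G" by blast
  qed
  then show ?thesis using sub by blast
qed

text \<open>From left to right, connected pieces are themselves admissible subgraphs, and
  \<open>card_arcs_bound_of_connected\<close> extends their bound to disconnected ones. From right
  to left, a subgraph with an arc has at least two vertices, so the count applies to it.\<close>

lemma primitively_log_divergent_iff:
  "primitively_log_divergent G \<longleftrightarrow> conn_graph G \<and> tight_circuit (pverts G) (parcs G)"
proof
  assume pld: "primitively_log_divergent G"
  then have G: "conn_graph G" "card (parcs G) + 4 = 4 * card (pverts G)"
    by (auto simp: primitively_log_divergent_def log_divergent_iff)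
  have sG: "simple_arcs (pverts G) (parcs G)" using G conn_graph_iff by blast
  have "card S + 6 \<le> 4 * card X"
    if X: "X \<subseteq> pverts G" "S \<subseteq> parcs G" "S \<noteq> parcs G" "simple_arcs X S" "2 \<le> card X" for X S
  proof (rule card_arcs_bound_of_connected[OF _ X(4,5)])
    fix Y T assume Y: "Y \<subseteq> X" "T \<subseteq> S" "simple_arcs Y T" "T \<noteq> {}"
      "\<forall>x\<in>Y. \<forall>y\<in>Y. (x, y) \<in> T\<^sup>*"
    let ?H = "\<lparr>pverts = Y, parcs = T\<rparr>"
    have "conn_graph ?H" using Y by (simp add: conn_graph_iff)
    moreover have "subgraph (with_proj ?H) (with_proj G) \<and> edges ?H \<subset> edges G"
      using proper_subgraph_iff[OF sG, of ?H] X Y by auto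
    ultimately have "convergent_graph ?H"
      using pld unfolding primitively_log_divergent_def by blast
    then show "card T + 6 \<le> 4 * card Y" by (simp add: convergent_graph_iff)
  qed
  then show "conn_graph G \<and> tight_circuit (pverts G) (parcs G)"
    using G unfolding tight_circuit_def by blast
next
  assume G: "conn_graph G \<and> tight_circuit (pverts G) (parcs G)"
  then have sG: "simple_arcs (pverts G) (parcs G)" using conn_graph_iff by blast
  have "convergent_graph H"
    if H: "conn_graph H" "subgraph (with_proj H) (with_proj G)" "edges H \<subset> edges G" for H
  proof -
    have sH: "simple_arcs (pverts H) (parcs H)" "parcs H \<noteq> {}" using H conn_graph_iff by blast+
    have "pverts H \<subseteq> pverts G \<and> parcs H \<subset> parcs G"
      using proper_subgraph_iff[OF sG sH(1)] H by blast
    moreover have "2 \<le> card (pverts H)"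
      using simple_arcs_small[OF sH(1)] sH(2) by fastforce
    ultimately have "card (parcs H) + 6 \<le> 4 * card (pverts H)"
      using G sH unfolding tight_circuit_def by blast
    then show ?thesis using H(1) by (simp add: convergent_graph_iff)
  qed
  then show "primitively_log_divergent G"
    using G unfolding primitively_log_divergent_def log_divergent_iff tight_circuit_def by blast
qed

text \<open>Fewer than two vertices carry no arcs, which gives the weaker bounds for small sets. The
  gluing needs them when a subgraph meets one side in at most one vertex.\<close>

lemma tight_circuit_bound:
  assumes "tight_circuit V R" "X \<subseteq> V" "S \<subseteq> R" "S \<noteq> R" "simple_arcs X S"
  shows "card S \<le> 4 * card X" "1 \<le> card X \<Longrightarrow> card S + 4 \<le> 4 * card X"
    "2 \<le> card X \<Longrightarrow> card S + 6 \<le> 4 * card X"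
proof -
  show *: "card S + 6 \<le> 4 * card X" if "2 \<le> card X"
    using assms that unfolding tight_circuit_def by blast
  have "card S = 0" if "card X < 2" using simple_arcs_small[OF assms(5) that] by simp
  then show "card S \<le> 4 * card X" "1 \<le> card X \<Longrightarrow> card S + 4 \<le> 4 * card X"
    using * by linarith+
qed

text \<open>If the edge were a bridge, each of the two sides \<open>Y\<close> and \<open>Z\<close>
  would satisfy the bound with constant 4. With the two arcs of the bridge this leaves at most
  \<open>4 * card V - 6\<close> arcs, fewer than a circuit has.\<close>

lemma tight_circuit_bridgeless:
  assumes circ: "tight_circuit V R" and s: "simple_arcs V R" and uv: "(u, v) \<in> R"
  shows "(u, v) \<in> (R - {(u, v), (v, u)})\<^sup>*"
proof (rule ccontr)
  let ?D = "R - {(u, v), (v, u)}"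
  assume nr: "(u, v) \<notin> ?D\<^sup>*"
  define Y where "Y = {z \<in> V. (u, z) \<in> ?D\<^sup>*}"
  define Z where "Z = V - Y"
  have V: "u \<in> V" "v \<in> V" "(v, u) \<in> R" using simple_arcsD[OF s uv] by simp_all
  have YZ: "Y \<union> Z = V" "Y \<inter> Z = {}" "u \<in> Y" "v \<in> Z" "Y \<subseteq> V" "Z \<subseteq> V"
    using V nr by (auto simp: Y_def Z_def)
  have finV: "finite V" using s by (simp add: simple_arcs_def)
  have fin: "finite Y" "finite Z" using finV YZ(5,6) finite_subset by blast+
  have cards: "card Y + card Z = card V" "1 \<le> card Y" "1 \<le> card Z"
    using card_Un_disjoint[OF fin YZ(2)] YZ fin by (auto simp: Suc_le_eq card_gt_0_iff)
  have part: "card (R \<inter> U \<times> U) + 4 \<le> 4 * card U"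
    if U: "U \<subseteq> V" "1 \<le> card U" "(u, v) \<notin> U \<times> U" for U
    by (rule tight_circuit_bound(2)[OF circ U(1) _ _ simple_arcs_restrict[OF s U(1)] U(2)])
      (use uv U in auto)
  have "R \<subseteq> ((R \<inter> Y \<times> Y) \<union> (R \<inter> Z \<times> Z)) \<union> {(u, v), (v, u)}"
  proof
    fix a assume "a \<in> R"
    obtain p q where a: "a = (p, q)" by (cases a)
    then have pq: "(p, q) \<in> R" "(q, p) \<in> R" "p \<in> V" "q \<in> V"
      using simple_arcsD[OF s, of p q] \<open>a \<in> R\<close> by simp_all
    show "a \<in> ((R \<inter> Y \<times> Y) \<union> (R \<inter> Z \<times> Z)) \<union> {(u, v), (v, u)}"
    proof (cases "a \<in> {(u, v), (v, u)}")
      case False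
      then have "(p, q) \<in> ?D" "(q, p) \<in> ?D" using pq a by auto
      then have "p \<in> Y \<longleftrightarrow> q \<in> Y"
        unfolding Y_def using pq(3,4) by (blast intro: rtrancl_into_rtrancl)
      then show ?thesis using pq a by (auto simp: Z_def)
    qed blast
  qed
  then have "card R \<le> card (((R \<inter> Y \<times> Y) \<union> (R \<inter> Z \<times> Z)) \<union> {(u, v), (v, u)})"
    by (rule card_mono[rotated]) (use fin in simp)
  also have "\<dots> \<le> card (R \<inter> Y \<times> Y) + card (R \<inter> Z \<times> Z) + card {(u, v), (v, u)}"
    by (rule order_trans[OF card_Un_le add_right_mono[OF card_Un_le]])
  finally have "card R \<le> card (R \<inter> Y \<times> Y) + card (R \<inter> Z \<times> Z) + card {(u, v), (v, u)}" .
  moreover have "card {(u, v), (v, u)} = 2" using simple_arcsD(4)[OF s uv] by simp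
  moreover have "card R + 4 = 4 * card V" using circ by (simp add: tight_circuit_def)
  moreover have "(u, v) \<notin> Y \<times> Y" "(u, v) \<notin> Z \<times> Z" using YZ by blast+
  ultimately show False using part[OF YZ(5)] part[OF YZ(6)] cards by linarith
qed

text \<open>Each passage through the deleted edge, in either direction, is replaced by the detour
  that \<open>tight_circuit_bridgeless\<close> provides.\<close>

lemma rtrancl_delete_edge:
  assumes "tight_circuit V R" "simple_arcs V R" "(u, v) \<in> R" "(x, y) \<in> R\<^sup>*"
  shows "(x, y) \<in> (R - {(u, v), (v, u)})\<^sup>*"
proof -
  let ?D = "R - {(u, v), (v, u)}"
  have vu: "(v, u) \<in> R" using simple_arcsD(1)[OF assms(2,3)] .
  have "(u, v) \<in> ?D\<^sup>*" using assms(1-3) by (rule tight_circuit_bridgeless)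
  moreover have "(v, u) \<in> ?D\<^sup>*"
    using tight_circuit_bridgeless[OF assms(1,2) vu] unfolding insert_commute[of "(v, u)"] .
  ultimately have "R \<subseteq> ?D\<^sup>*" by blast
  then have "R\<^sup>* \<subseteq> ?D\<^sup>*" by (rule rtrancl_subset_rtrancl)
  then show ?thesis using assms(4) by blast
qed

lemma rtrancl_map_prod:
  assumes "(x, y) \<in> R\<^sup>*" "map_prod f f ` R \<subseteq> Q"
  shows "(f x, f y) \<in> Q\<^sup>*"
  using assms(1)
proof induction
  case (step y z)
  have "(f y, f z) \<in> Q" using step(2) assms(2) by force
  with step(3) show ?case by (rule rtrancl_into_rtrancl)
qed simp

section \<open>Gluing two circuits along an edge\<close>

text \<open>Embedding both graphs into a common vertex type by \<open_placeholder>\<close>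

locale two_sum =
  fixes V1 :: "'a set" and R1 u v and V2 :: "'b set" and R2 u' v'
    and f :: "'a \<Rightarrow> 'c" and g :: "'b \<Rightarrow> 'c"
  assumes s1: "simple_arcs V1 R1" and s2: "simple_arcs V2 R2"
    and e1: "(u, v) \<in> R1" and e2: "(u', v') \<in> R2"
    and inj_f: "inj f" and inj_g: "inj g"
    and fg: "f u = g u'" "f v = g v'"
    and fg_cases: "f x = g y \<Longrightarrow> x = u \<and> y = u' \<or> x = v \<and> y = v'"
begin

definition "D1 = R1 - {(u, v), (v, u)}"
definition "D2 = R2 - {(u', v'), (v', u')}"
definition "W = f ` V1 \<union> g ` V2"
definition "Q = map_prod f f ` D1 \<union> map_prod g g ` D2"

lemmas uv = simple_arcsD[OF s1 e1] and uv' = simple_arcsD[OF s2 e2]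

lemma D1_arcD: "(x, y) \<in> D1 \<Longrightarrow> (y, x) \<in> D1 \<and> x \<in> V1 \<and> y \<in> V1 \<and> x \<noteq> y"
  using simple_arcsD[OF s1, of x y] unfolding D1_def by blast

lemma D2_arcD: "(x, y) \<in> D2 \<Longrightarrow> (y, x) \<in> D2 \<and> x \<in> V2 \<and> y \<in> V2 \<and> x \<noteq> y"
  using simple_arcsD[OF s2, of x y] unfolding D2_def by blast

lemma finite_sides: "finite V1" "finite V2" "finite D1" "finite D2"
  using s1 s2 simple_arcs_finite unfolding simple_arcs_def D1_def D2_def by blast+

lemma pieces_disjoint: "map_prod f f ` D1 \<inter> map_prod g g ` D2 = {}"
proof (rule equals0I)
  fix a assume "a \<in> map_prod f f ` D1 \<inter> map_prod g g ` D2"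
  then obtain x y p q where *: "(x, y) \<in> D1" "(p, q) \<in> D2" "f x = g p" "f y = g q" by auto
  from fg_cases[OF *(3)] fg_cases[OF *(4)] D1_arcD[OF *(1)] *(1) show False
    unfolding D1_def by blast
qed

lemma Q_simple: "simple_arcs W Q"
proof -
  have "(b, a) \<in> Q \<and> a \<in> W \<and> b \<in> W \<and> a \<noteq> b" if "(a, b) \<in> Q" for a b
  proof -
    from that consider "(a, b) \<in> map_prod f f ` D1" | "(a, b) \<in> map_prod g g ` D2"
      unfolding Q_def by blast
    then show ?thesis
    proof cases
      case 1
      then obtain x y where xy: "a = f x" "b = f y" "(x, y) \<in> D1" by auto
      have "(b, a) \<in> map_prod f f ` D1" using xy D1_arcD[OF xy(3)] by force
      moreover have "a \<noteq> b" using xy D1_arcD[OF xy(3)] inj_eq[OF inj_f] by simp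
      ultimately show ?thesis using xy D1_arcD[OF xy(3)] unfolding Q_def W_def by blast
    next
      case 2
      then obtain x y where xy: "a = g x" "b = g y" "(x, y) \<in> D2" by auto
      have "(b, a) \<in> map_prod g g ` D2" using xy D2_arcD[OF xy(3)] by force
      moreover have "a \<noteq> b" using xy D2_arcD[OF xy(3)] inj_eq[OF inj_g] by simp
      ultimately show ?thesis using xy D2_arcD[OF xy(3)] unfolding Q_def W_def by blast
    qed
  qed
  moreover have "finite W" using finite_sides by (simp add: W_def)
  ultimately show ?thesis by (intro simple_arcsI)
qed

lemma card_pieces:
  assumes "S1 \<subseteq> D1" "S2 \<subseteq> D2"
  shows "card (map_prod f f ` S1 \<union> map_prod g g ` S2) = card S1 + card S2"
proof -
  have "finite S1" "finite S2" using assms finite_sides finite_subset by blast+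
  moreover have "map_prod f f ` S1 \<inter> map_prod g g ` S2 = {}"
    using Int_mono[OF assms[THEN image_mono], of "map_prod f f" "map_prod g g"]
    unfolding pieces_disjoint by (rule subset_empty[THEN iffD1])
  moreover have "card (map_prod f f ` S1) = card S1" "card (map_prod g g ` S2) = card S2"
    using prod.inj_map[OF inj_f inj_f] prod.inj_map[OF inj_g inj_g]
    by (auto intro!: card_image elim: inj_on_subset)
  ultimately show ?thesis by (simp add: card_Un_disjoint)
qed

lemma card_vertices:
  assumes "X1 \<subseteq> V1" "X2 \<subseteq> V2"
  shows "card X1 + card X2 = card (f ` X1 \<union> g ` X2) + card (f ` X1 \<inter> g ` X2)"
proof -
  have "finite X1" "finite X2" using assms finite_sides finite_subset by blast+
  then show ?thesis
    using card_Un_Int[of "f ` X1" "g ` X2"] inj_f inj_g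
    by (simp add: card_image inj_on_subset)
qed

lemma f_u_neq_f_v: "f u \<noteq> f v"
  using uv(4) inj_f by (auto simp: inj_def)

lemma card_W: "card W + 2 = card V1 + card V2"
proof -
  have "f ` V1 \<inter> g ` V2 = {f u, f v}" using fg fg_cases uv uv' by force
  then show ?thesis using card_vertices[of V1 V2] f_u_neq_f_v by (simp add: W_def)
qed

lemma card_D: "card D1 + 2 = card R1" "card D2 + 2 = card R2"
proof -
  have "insert (u, v) (insert (v, u) D1) = R1" "insert (u', v') (insert (v', u') D2) = R2"
    using uv(1) uv'(1) e1 e2 by (auto simp: D1_def D2_def)
  then have "card (insert (u, v) (insert (v, u) D1)) = card R1"
    "card (insert (u', v') (insert (v', u') D2)) = card R2" by simp_all
  moreover have "(u, v) \<notin> insert (v, u) D1" "(v, u) \<notin> D1"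
    "(u', v') \<notin> insert (v', u') D2" "(v', u') \<notin> D2"
    using uv(4) uv'(4) by (auto simp: D1_def D2_def)
  ultimately show "card D1 + 2 = card R1" "card D2 + 2 = card R2"
    using finite_sides by simp_all
qed

lemma Q_connected:
  assumes "tight_circuit V1 R1" "tight_circuit V2 R2"
    and c1: "\<forall>x\<in>V1. \<forall>y\<in>V1. (x, y) \<in> R1\<^sup>*" and c2: "\<forall>x\<in>V2. \<forall>y\<in>V2. (x, y) \<in> R2\<^sup>*"
    and "a \<in> W" "b \<in> W"
  shows "(a, b) \<in> Q\<^sup>*"
proof -
  have F: "(f x, f y) \<in> Q\<^sup>*" if "x \<in> V1" "y \<in> V1" for x y
    by (rule rtrancl_map_prod[OF rtrancl_delete_edge[OF assms(1) s1 e1]])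
      (use c1 that in \<open>auto simp: Q_def D1_def\<close>)
  have G: "(g x, g y) \<in> Q\<^sup>*" if "x \<in> V2" "y \<in> V2" for x y
    by (rule rtrancl_map_prod[OF rtrancl_delete_edge[OF assms(2) s2 e2]])
      (use c2 that in \<open>auto simp: Q_def D2_def\<close>)
  have "(c, f u) \<in> Q\<^sup>* \<and> (f u, c) \<in> Q\<^sup>*" if "c \<in> W" for c
    using that unfolding W_def
  proof
    assume "c \<in> f ` V1"
    then show ?thesis using F uv(2) by blast
  next
    assume "c \<in> g ` V2"
    then show ?thesis using G uv'(2) unfolding fg(1) by blast
  qed
  from this[OF assms(5)] this[OF assms(6)] show ?thesis by (meson rtrancl_trans)
qed

lemma tight_circuit_Q:
  assumes t1: "tight_circuit V1 R1" and t2: "tight_circuit V2 R2"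
  shows "tight_circuit W Q"
proof -
  have "card Q + 4 = 4 * card W"
  proof -
    have "card Q = card D1 + card D2" unfolding Q_def by (rule card_pieces) auto
    moreover have "card R1 + 4 = 4 * card V1" "card R2 + 4 = 4 * card V2"
      using t1 t2 by (auto simp: tight_circuit_def)
    ultimately show ?thesis using card_D card_W by linarith
  qed
  moreover have "card S + 6 \<le> 4 * card X"
    if X: "X \<subseteq> W" and S: "S \<subseteq> Q" "S \<noteq> Q" and sS: "simple_arcs X S" and cX: "2 \<le> card X" for X S
  proof -
    define X1 X2 where "X1 = {x \<in> V1. f x \<in> X}" and "X2 = {x \<in> V2. g x \<in> X}"
    define S1 S2 where "S1 = {(x, y). (x, y) \<in> D1 \<and> (f x, f y) \<in> S}"
      and "S2 = {(x, y). (x, y) \<in> D2 \<and> (g x, g y) \<in> S}"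
    have XV: "X1 \<subseteq> V1" "X2 \<subseteq> V2" by (auto simp: X1_def X2_def)
    have SD: "S1 \<subseteq> D1" "S2 \<subseteq> D2" by (auto simp: S1_def S2_def)
    have SR: "S1 \<subseteq> R1" "S1 \<noteq> R1" "S2 \<subseteq> R2" "S2 \<noteq> R2"
      using SD e1 e2 unfolding D1_def D2_def by blast+
    have "X = f ` X1 \<union> g ` X2" using X unfolding W_def X1_def X2_def by blast
    moreover have "f ` X1 \<inter> g ` X2 = X \<inter> {f u, f v}"
      using fg fg_cases uv uv' by (fastforce simp: X1_def X2_def)
    ultimately have cards: "card X1 + card X2 = card X + card (X \<inter> {f u, f v})"
      using card_vertices[OF XV] by simp
    have "S = map_prod f f ` S1 \<union> map_prod g g ` S2"
      using S(1) unfolding Q_def S1_def S2_def by fastforce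
    then have cS: "card S = card S1 + card S2" and SDne: "S1 \<noteq> D1 \<or> S2 \<noteq> D2"
      using card_pieces[OF SD] S(2) by (auto simp: Q_def)
    have fin: "finite X1" "finite X2" using finite_sides XV finite_subset by blast+
    have s1': "(y, x) \<in> S1 \<and> x \<in> X1 \<and> y \<in> X1 \<and> x \<noteq> y" if "(x, y) \<in> S1" for x y
      using that D1_arcD[of x y] simple_arcsD[OF sS, of "f x" "f y"] by (simp add: S1_def X1_def)
    have s2': "(y, x) \<in> S2 \<and> x \<in> X2 \<and> y \<in> X2 \<and> x \<noteq> y" if "(x, y) \<in> S2" for x y
      using that D2_arcD[of x y] simple_arcsD[OF sS, of "g x" "g y"] by (simp add: S2_def X2_def)
    have ss: "simple_arcs X1 S1" "simple_arcs X2 S2"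
      using simple_arcsI[OF fin(1) s1'] simple_arcsI[OF fin(2) s2'] by simp_all
    note b1 = tight_circuit_bound[OF t1 XV(1) SR(1,2) ss(1)]
    note b2 = tight_circuit_bound[OF t2 XV(2) SR(3,4) ss(2)]
    have mem: "u \<in> X1 \<longleftrightarrow> f u \<in> X" "v \<in> X1 \<longleftrightarrow> f v \<in> X"
      "u' \<in> X2 \<longleftrightarrow> f u \<in> X" "v' \<in> X2 \<longleftrightarrow> f v \<in> X"
      using uv uv' fg by (auto simp: X1_def X2_def)
    consider (none) "X \<inter> {f u, f v} = {}" | (one) "card (X \<inter> {f u, f v}) = 1" "X1 \<noteq> {}" "X2 \<noteq> {}"
      | (both) "f u \<in> X" "f v \<in> X"
    proof (cases "f u \<in> X"; cases "f v \<in> X")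
      assume "f u \<in> X" "f v \<notin> X"
      then have "X \<inter> {f u, f v} = {f u}" "X1 \<noteq> {}" "X2 \<noteq> {}" using mem by auto
      then show thesis by (intro one) simp_all
    next
      assume "f u \<notin> X" "f v \<in> X"
      then have "X \<inter> {f u, f v} = {f v}" "X1 \<noteq> {}" "X2 \<noteq> {}" using mem by auto
      then show thesis by (intro one) simp_all
    qed (use none both in blast)+
    then show ?thesis
    proof cases
      case none
      then have "card X1 + card X2 = card X" using cards by simp
      then show ?thesis using b1 b2 cS cX by linarith
    next
      case one
      then have "1 \<le> card X1" "1 \<le> card X2" using fin by (auto simp: Suc_le_eq card_gt_0_iff)
      then show ?thesis using b1 b2 cS cX cards one(1) by linarith
    next
      case both
      then have "X \<inter> {f u, f v} = {f u, f v}" by blast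
      then have n: "card X1 + card X2 = card X + 2" using cards f_u_neq_f_v by simp
      have in1: "{u, v} \<subseteq> X1" and in2: "{u', v'} \<subseteq> X2" using both mem by auto
      have c2: "2 \<le> card X1" "2 \<le> card X2"
        using card_mono[OF fin(1) in1] card_mono[OF fin(2) in2] uv(4) uv'(4) by simp_all
      \<comment> \<open>A side that is not exhausted can take back its deleted edge and still be a proper
        subgraph, which saves one edge.\<close>
      from SDne show ?thesis
      proof
        assume ne: "S1 \<noteq> D1"
        let ?T = "insert (u, v) (insert (v, u) S1)"
        have nin: "(u, v) \<notin> insert (v, u) S1" "(v, u) \<notin> S1"
          using SD uv(4) by (auto simp: D1_def)
        have fS: "finite S1" using SD finite_sides finite_subset by blast
        have "?T \<noteq> R1" using ne SD nin unfolding D1_def by blast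
        moreover have "?T \<subseteq> R1" using SR e1 uv(1) by blast
        moreover have "simple_arcs X1 ?T"
        proof (rule simple_arcsI[OF fin(1)])
          fix x y assume "(x, y) \<in> ?T"
          then show "(y, x) \<in> ?T \<and> x \<in> X1 \<and> y \<in> X1 \<and> x \<noteq> y"
            using s1'[of x y] in1 uv(4) by blast
        qed
        ultimately have "card ?T + 6 \<le> 4 * card X1"
          using tight_circuit_bound(3)[OF t1 XV(1)] c2 by blast
        then show ?thesis using b2(3)[OF c2(2)] nin fS n cS by simp
      next
        assume ne: "S2 \<noteq> D2"
        let ?T = "insert (u', v') (insert (v', u') S2)"
        have nin: "(u', v') \<notin> insert (v', u') S2" "(v', u') \<notin> S2"
          using SD uv'(4) by (auto simp: D2_def)
        have fS: "finite S2" using SD finite_sides finite_subset by blast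
        have "?T \<noteq> R2" using ne SD nin unfolding D2_def by blast
        moreover have "?T \<subseteq> R2" using SR e2 uv'(1) by blast
        moreover have "simple_arcs X2 ?T"
        proof (rule simple_arcsI[OF fin(2)])
          fix x y assume "(x, y) \<in> ?T"
          then show "(y, x) \<in> ?T \<and> x \<in> X2 \<and> y \<in> X2 \<and> x \<noteq> y"
            using s2'[of x y] in2 uv'(4) by blast
        qed
        ultimately have "card ?T + 6 \<le> 4 * card X2"
          using tight_circuit_bound(3)[OF t2 XV(2)] c2 by blast
        then show ?thesis using b1(3)[OF c2(1)] nin fS n cS by simp
      qed
    qed
  qed
  ultimately show ?thesis unfolding tight_circuit_def by blast
qed

end

lemma gluing_eq:
  fixes G :: "'a pair_pre_digraph" and G' :: "'b pair_pre_digraph" and u v u' v'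
  defines "k \<equiv> identify_map u v u' v' \<circ> Inr"
  shows "pverts (gluing G u v G' u' v') = Inl ` pverts G \<union> k ` pverts G'"
    and "parcs (gluing G u v G' u' v') =
      map_prod Inl Inl ` (parcs G - {(u, v), (v, u)}) \<union>
      map_prod k k ` (parcs G' - {(u', v'), (v', u')})"
proof -
  let ?q = "identify_map u v u' v'"
  have q: "?q \<circ> Inl = Inl" by (simp add: identify_map_def fun_eq_iff)
  have "parcs (delete_edge (delete_edge (disj_union G G') (Inl u) (Inl v)) (Inr u') (Inr v')) =
      map_prod Inl Inl ` (parcs G - {(u, v), (v, u)}) \<union>
      map_prod Inr Inr ` (parcs G' - {(u', v'), (v', u')})"
    by (auto simp: delete_edge_def disj_union_def)
  then show "parcs (gluing G u v G' u' v') =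
      map_prod Inl Inl ` (parcs G - {(u, v), (v, u)}) \<union>
      map_prod k k ` (parcs G' - {(u', v'), (v', u')})"
    by (simp add: gluing_def image_graph_def image_Un image_comp map_prod_compose[symmetric] q k_def)
  show "pverts (gluing G u v G' u' v') = Inl ` pverts G \<union> k ` pverts G'"
    by (simp add: gluing_def image_graph_def delete_edge_def disj_union_def Plus_def image_Un
        image_comp q k_def)
qed

theorem theorem3p3p3:
  fixes G :: "'a pair_pre_digraph" and G' :: "'b pair_pre_digraph"
    and u v :: 'a and u' v' :: 'b
  assumes "primitively_log_divergent G" and "primitively_log_divergent G'"
    and "(u, v) \<in> parcs G" and "(u', v') \<in> parcs G'"
  shows "primitively_log_divergent (gluing G u v G' u' v')"
proof -
  define k where "k = identify_map u v u' v' \<circ> Inr"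
  have G: "simple_arcs (pverts G) (parcs G)" "tight_circuit (pverts G) (parcs G)"
      "\<forall>x\<in>pverts G. \<forall>y\<in>pverts G. (x, y) \<in> (parcs G)\<^sup>*"
    and G': "simple_arcs (pverts G') (parcs G')" "tight_circuit (pverts G') (parcs G')"
      "\<forall>x\<in>pverts G'. \<forall>y\<in>pverts G'. (x, y) \<in> (parcs G')\<^sup>*"
    using assms(1,2) unfolding primitively_log_divergent_iff conn_graph_iff by blast+
  have ne: "u \<noteq> v" "u' \<noteq> v'"
    using simple_arcsD(4)[OF G(1) assms(3)] simple_arcsD(4)[OF G'(1) assms(4)] .
  interpret two_sum "pverts G" "parcs G" u v "pverts G'" "parcs G'" u' v' Inl k
    by unfold_locales
      (use assms(3,4) G G' ne in \<open>auto simp: k_def identify_map_def inj_def split: if_splits\<close>)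
  let ?H = "gluing G u v G' u' v'"
  have H: "pverts ?H = W" "parcs ?H = Q"
    unfolding gluing_eq W_def Q_def D1_def D2_def by (simp_all only: k_def)
  have t: "tight_circuit W Q" using G(2) G'(2) by (rule tight_circuit_Q)
  have "2 \<le> card W"
  proof -
    have "{Inl u, Inl v} \<subseteq> W" using uv by (auto simp: W_def)
    moreover have "finite W" using Q_simple by (simp add: simple_arcs_def)
    ultimately show ?thesis using card_mono[of W "{Inl u, Inl v}"] ne by simp
  qed
  then have "Q \<noteq> {}" using t by (auto simp: tight_circuit_def)
  then have "conn_graph ?H"
    using Q_simple Q_connected[OF G(2) G'(2) G(3) G'(3)] by (simp add: conn_graph_iff H)
  then show ?thesis using t by (simp add: primitively_log_divergent_iff H)
qed

end
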